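(* Let $A=X\cup Y$ be a partition of the set of options into two disjoint non-empty sets. Suppose that the individual votes are rankings, possibly truncated or with ties, and let $v$ be the resulting Llull matrix. If $v_{xy}=1$ for all $x\in X$ and $y\in Y$, then $R_x=\widetilde R_x$ for all $x\in X$, where $R_x$ are the rank-like rates obtained from $v$ on $A$ and $\widetilde R_x$ are the rank-like rates obtained on the option set $X$ (with $|X|$ in the role of $N$) from the submatrix $(v_{x\bar x})_{x,\bar x\in X,\,x\ne\bar x}$.
   Context: Let $A$ be a finite set of $N$ options and $\Pi=\{(x,y)\in A\times A : x\neq y\}$; a pair $(x,y)$ is written $xy$. Let $\Omega=\{v\in[0,1]^{\Pi} : v_{xy}+v_{yx}\le 1 \text{ for all } xy\in\Pi\}$; its elements are called Llull matrices. For $v\in\Omega$ put $t_{xy}=v_{xy}+v_{yx}$ (turnouts). Ranking votes: the collective Llull matrix is $v=\sum_k\alpha_k v^k$ (finite sum), with $\alpha_k>0$, $\sum_k\alpha_k=1$, the relative frequencies of the individual votes. Each vote $k$ is a list of some of the options (a subset of $A$) in order of preference, ties being allowed (a weak order on the listed options). It is translated into $v^k\in\Omega$ by: (a) if $x,y$ are both listed and $x$ is ranked strictly above $y$, then $v^k_{xy}=1$, $v^k_{yx}=0$; (b) if $x,y$ are both listed and tied, then $v^k_{xy}=v^k_{yx}=1/2$; (c) if $x$ is listed and $y$ is not, then $v^k_{xy}=1$, $v^k_{yx}=0$; (d) if neither is listed, then $v^k_{xy}=v^k_{yx}=0$. CLC procedure applied to a Llull matrix $v\in\Omega$ on a finite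 option set $A$ with $N$ elements: (1) Indirect scores: $v^*_{xy}=\max\min_{0\le i<n} v_{x_ix_{i+1}}$, the maximum being over all paths $x_0x_1\dots x_n$ ($n\ge1$, consecutive elements distinct) in $A$ with $x_0=x$, $x_n=y$. Indirect margins: $m^{\kappa}_{xy}=v^*_{xy}-v^*_{yx}$. (2) Indirect comparison relation: $\kappa=\{xy\in\Pi : m^{\kappa}_{xy}>0\}$ (it is transitive). An admissible order is any strict total order $\xi\subseteq\Pi$ on $A$ with $\kappa\subseteq\xi$. Fix an admissible order $\xi$. Write $x\succ_\xi y$ for $xy\in\xi$, and $x\succeq_\xi y$ for ($xy\in\xi$ or $x=y$). For $x$ not last in $\xi$, $x'$ denotes the immediate successor of $x$ in $\xi$ (the element following $x$). (3) For each non-last $x$: $m^{\sigma}_{xx'}=\min\{m^{\kappa}_{pq} : p\succeq_\xi x,\ x'\succeq_\xi q\}$. (4) $(t^{\sigma}_{xy})$ is the unique minimizer of $\sum_{x}\sum_{y\neq x}(\tau_{xy}-t_{xy})^2$ over all $\tau\in\mathbb{R}^{\Pi}$ satisfying: $\tau_{xy}=\tau_{yx}$ for all $xy\in\Pi$; $m^{\sigma}_{xx'}\le\tau_{xx'}\le1$ for all non-last $x$; and $0\le\tau_{xz}-\tau_{x'z}\le m^{\sigma}_{xx'}$ for all non-last $x$ and all $z\notin\{x,x'\}$. (5) Projected scores: $v^{\pi}_{xx'}=(t^{\sigma}_{xx'}+m^{\sigma}_{xx'})/2$, $v^{\pi}_{x'x}=(t^{\sigma}_{xx'}-m^{\sigma}_{xx'})/2$,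 and for $x\succ_\xi y$: $v^{\pi}_{xy}=\max\{v^{\pi}_{pp'} : x\succeq_\xi p\succ_\xi y\}$, $v^{\pi}_{yx}=\min\{v^{\pi}_{p'p} : x\succeq_\xi p\succ_\xi y\}$. (6) Rank-like rates: $R_x=N-\sum_{y\neq x}v^{\pi}_{xy}$. The projected scores and rank-like rates do not depend on the choice of the admissible order $\xi$, so they are functions of $v$. *)

theory Defs
  imports Complex_Main "HOL-Library.FuncSet"
begin

(* Real functions on the set of ordered pairs of distinct options are extensional functions,
   i.e. elements of "opairs A \<rightarrow>\<^sub>E B": they are fixed to "undefined" outside opairs A, so that
   equality of two such functions is equality on opairs A. *)

definition opairs :: "'a set \<Rightarrow> ('a \<times> 'a) set" where
  "opairs A = {(x, y). x \<in> A \<and> y \<in> A \<and> x \<noteq> y}"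

definition llull_matrices :: "'a set \<Rightarrow> ('a \<times> 'a \<Rightarrow> real) set" where
  "llull_matrices A = {v \<in> opairs A \<rightarrow>\<^sub>E {0..1}. \<forall>(x, y)\<in>opairs A. v (x, y) + v (y, x) \<le> 1}"

definition turnout :: "('a \<times> 'a \<Rightarrow> real) \<Rightarrow> 'a \<times> 'a \<Rightarrow> real" where
  "turnout v = (\<lambda>(x, y). v (x, y) + v (y, x))"


(* A vote is a pair of the set L of listed options and a weak order W on L, where (x, y) \<in> W
   means that x is ranked at least as high as y.  Truncation is L \<noteq> A; x and y are tied iff
   both (x, y) and (y, x) belong to W. *)

definition ranking_vote :: "'a set \<Rightarrow> 'a set \<Rightarrow> 'a rel \<Rightarrow> bool" where
  "ranking_vote A L W \<longleftrightarrow> L \<subseteq> A \<and> preorder_on L W \<and> total_on L W"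

definition vote_matrix :: "'a set \<Rightarrow> 'a set \<Rightarrow> 'a rel \<Rightarrow> 'a \<times> 'a \<Rightarrow> real" where
  "vote_matrix A L W = (\<lambda>(x, y)\<in>opairs A.
     if x \<in> L \<and> y \<in> L then
       (if (x, y) \<in> W \<and> (y, x) \<notin> W then 1
        else if (y, x) \<in> W \<and> (x, y) \<notin> W then 0
        else 1/2)
     else if x \<in> L \<and> y \<notin> L then 1
     else 0)"

definition collective_matrix ::
  "'a set \<Rightarrow> 'k set \<Rightarrow> ('k \<Rightarrow> real) \<Rightarrow> ('k \<Rightarrow> 'a set) \<Rightarrow> ('k \<Rightarrow> 'a rel) \<Rightarrow> 'a \<times> 'a \<Rightarrow> real" where
  "collective_matrix A K \<alpha> L W =
     (\<lambda>xy\<in>opairs A. \<Sum>k\<in>K. \<alpha> k * vote_matrix A (L k) (W k) xy)"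

lemma vote_matrix_llull: "vote_matrix A L W \<in> llull_matrices A"
  by (auto simp: llull_matrices_def vote_matrix_def opairs_def)

lemma collective_matrix_llull:
  assumes "\<And>k. k \<in> K \<Longrightarrow> \<alpha> k > 0" and "(\<Sum>k\<in>K. \<alpha> k) = 1"
  shows "collective_matrix A K \<alpha> L W \<in> llull_matrices A"
proof -
  let ?u = "\<lambda>k. vote_matrix A (L k) (W k)"
  have u: "?u k (x, y) \<ge> 0" "?u k (x, y) + ?u k (y, x) \<le> 1"
    if "(x, y) \<in> opairs A" for k x y
    using vote_matrix_llull[of A "L k" "W k"] that by (auto simp: llull_matrices_def PiE_iff)
  have sym: "(y, x) \<in> opairs A" if "(x, y) \<in> opairs A" for x y
    using that by (auto simp: opairs_def)
  have nonneg: "(\<Sum>k\<in>K. \<alpha> k * ?u k (x, y)) \<ge> 0" if "(x, y) \<in> opairs A" for x y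
    using assms(1) u(1)[OF that] by (intro sum_nonneg mult_nonneg_nonneg) (auto simp: less_imp_le)
  have le: "(\<Sum>k\<in>K. \<alpha> k * ?u k (x, y)) + (\<Sum>k\<in>K. \<alpha> k * ?u k (y, x)) \<le> 1"
    if "(x, y) \<in> opairs A" for x y
  proof -
    have "(\<Sum>k\<in>K. \<alpha> k * ?u k (x, y)) + (\<Sum>k\<in>K. \<alpha> k * ?u k (y, x))
        = (\<Sum>k\<in>K. \<alpha> k * (?u k (x, y) + ?u k (y, x)))"
      by (simp add: sum.distrib distrib_left)
    also have "\<dots> \<le> (\<Sum>k\<in>K. \<alpha> k * 1)"
      using assms(1) u(2)[OF that] by (intro sum_mono mult_left_mono) (auto simp: less_imp_le)
    finally show ?thesis using assms(2) by simp
  qed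
  have le1: "(\<Sum>k\<in>K. \<alpha> k * ?u k (x, y)) \<le> 1" if "(x, y) \<in> opairs A" for x y
    using le[OF that] nonneg[OF sym[OF that]] by linarith
  show ?thesis
    unfolding llull_matrices_def collective_matrix_def
    using nonneg le le1 sym by (auto simp: PiE_iff)
qed


(* The CLC procedure.  A path x0 x1 ... xn is the list of its n + 1 \<ge> 2 vertices. *)

definition paths :: "'a set \<Rightarrow> 'a \<Rightarrow> 'a \<Rightarrow> 'a list set" where
  "paths A x y = {p. length p \<ge> 2 \<and> set p \<subseteq> A \<and> distinct_adj p \<and> hd p = x \<and> last p = y}"

definition path_score :: "('a \<times> 'a \<Rightarrow> real) \<Rightarrow> 'a list \<Rightarrow> real" where
  "path_score v p = Min {v (p ! i, p ! Suc i) | i. Suc i < length p}"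

(* For finite A there may be infinitely many paths, but only finitely many path scores. *)
definition indirect_score :: "'a set \<Rightarrow> ('a \<times> 'a \<Rightarrow> real) \<Rightarrow> 'a \<Rightarrow> 'a \<Rightarrow> real" where
  "indirect_score A v x y = Max (path_score v ` paths A x y)"

definition indirect_margin :: "'a set \<Rightarrow> ('a \<times> 'a \<Rightarrow> real) \<Rightarrow> 'a \<Rightarrow> 'a \<Rightarrow> real" where
  "indirect_margin A v x y = indirect_score A v x y - indirect_score A v y x"

definition indirect_comparison :: "'a set \<Rightarrow> ('a \<times> 'a \<Rightarrow> real) \<Rightarrow> 'a rel" where
  "indirect_comparison A v = {(x, y) \<in> opairs A. indirect_margin A v x y > 0}"

(* (x, y) \<in> \<xi> means that x precedes y; weak precedence is the reflexive closure \<xi>\<^sup>=. *)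
definition admissible_order :: "'a set \<Rightarrow> ('a \<times> 'a \<Rightarrow> real) \<Rightarrow> 'a rel \<Rightarrow> bool" where
  "admissible_order A v \<xi> \<longleftrightarrow>
     \<xi> \<subseteq> opairs A \<and> strict_linear_order_on A \<xi> \<and> indirect_comparison A v \<subseteq> \<xi>"

(* In a strict total order \<xi> on a finite set the options which are not last are exactly those
   in Domain \<xi>; next_option is meaningful only for them. *)
definition next_option :: "'a rel \<Rightarrow> 'a \<Rightarrow> 'a" where
  "next_option \<xi> x = (THE y. (x, y) \<in> \<xi> \<and> \<not> (\<exists>z. (x, z) \<in> \<xi> \<and> (z, y) \<in> \<xi>))"

(* The margin between x and its successor. *)
definition projected_margin :: "'a set \<Rightarrow> ('a \<times> 'a \<Rightarrow> real) \<Rightarrow> 'a rel \<Rightarrow> 'a \<Rightarrow> real" where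
  "projected_margin A v \<xi> x =
     Min {indirect_margin A v p q | p q. p \<in> A \<and> q \<in> A \<and> (p, x) \<in> \<xi>\<^sup>= \<and> (next_option \<xi> x, q) \<in> \<xi>\<^sup>=}"

definition feasible_turnouts ::
  "'a set \<Rightarrow> ('a \<times> 'a \<Rightarrow> real) \<Rightarrow> 'a rel \<Rightarrow> ('a \<times> 'a \<Rightarrow> real) set" where
  "feasible_turnouts A v \<xi> = {\<tau> \<in> opairs A \<rightarrow>\<^sub>E UNIV.
     (\<forall>(x, y)\<in>opairs A. \<tau> (x, y) = \<tau> (y, x)) \<and>
     (\<forall>x\<in>Domain \<xi>. projected_margin A v \<xi> x \<le> \<tau> (x, next_option \<xi> x) \<and>
                     \<tau> (x, next_option \<xi> x) \<le> 1) \<and>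
     (\<forall>x\<in>Domain \<xi>. \<forall>z\<in>A - {x, next_option \<xi> x}.
        0 \<le> \<tau> (x, z) - \<tau> (next_option \<xi> x, z) \<and>
        \<tau> (x, z) - \<tau> (next_option \<xi> x, z) \<le> projected_margin A v \<xi> x)}"

definition projected_turnout ::
  "'a set \<Rightarrow> ('a \<times> 'a \<Rightarrow> real) \<Rightarrow> 'a rel \<Rightarrow> 'a \<times> 'a \<Rightarrow> real" where
  "projected_turnout A v \<xi> =
     (THE \<tau>. is_arg_min (\<lambda>\<tau>. \<Sum>x\<in>A. \<Sum>y\<in>A - {x}. (\<tau> (x, y) - turnout v (x, y))\<^sup>2)
                        (\<lambda>\<tau>. \<tau> \<in> feasible_turnouts A v \<xi>) \<tau>)"

(* Projected scores of x against its successor and of the successor against x. *)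
definition upper_score :: "'a set \<Rightarrow> ('a \<times> 'a \<Rightarrow> real) \<Rightarrow> 'a rel \<Rightarrow> 'a \<Rightarrow> real" where
  "upper_score A v \<xi> x =
     (projected_turnout A v \<xi> (x, next_option \<xi> x) + projected_margin A v \<xi> x) / 2"

definition lower_score :: "'a set \<Rightarrow> ('a \<times> 'a \<Rightarrow> real) \<Rightarrow> 'a rel \<Rightarrow> 'a \<Rightarrow> real" where
  "lower_score A v \<xi> x =
     (projected_turnout A v \<xi> (x, next_option \<xi> x) - projected_margin A v \<xi> x) / 2"

(* In the else branch y precedes x, so the roles of x and y are exchanged.  When one of x, y
   is the successor of the other, the Max or Min is over a singleton. *)
definition projected_score ::
  "'a set \<Rightarrow> ('a \<times> 'a \<Rightarrow> real) \<Rightarrow> 'a rel \<Rightarrow> 'a \<Rightarrow> 'a \<Rightarrow> real" where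
  "projected_score A v \<xi> x y =
     (if (x, y) \<in> \<xi> then Max {upper_score A v \<xi> p | p. (x, p) \<in> \<xi>\<^sup>= \<and> (p, y) \<in> \<xi>}
      else Min {lower_score A v \<xi> p | p. (y, p) \<in> \<xi>\<^sup>= \<and> (p, x) \<in> \<xi>})"

definition rank_like_rate :: "'a set \<Rightarrow> ('a \<times> 'a \<Rightarrow> real) \<Rightarrow> 'a rel \<Rightarrow> 'a \<Rightarrow> real" where
  "rank_like_rate A v \<xi> x = real (card A) - (\<Sum>y\<in>A - {x}. projected_score A v \<xi> x y)"

end

theory Submission
  imports Defs "HOL-Analysis.Analysis"
begin

text \<open>Since every vote must list all of \<open>X\<close>, all turnouts of pairs meeting \<open>X\<close> are 1, and they remain 1
  after projection. As no vote prefers an element of \<open>Y\<close> to one of \<open>X\<close>, paths through \<open>Y\<close> do not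
  affect the indirect scores on \<open>X\<close>, \<open>X\<close> is an initial segment of \<open>\<xi>\<close>, and every element of \<open>X\<close>
  has projected score 1 against \<open>Y\<close>. Within \<open>X\<close> the projected scores become
  \<open>(1 + S x y - S y x) / 2\<close>, where \<open>S x y\<close> is the largest nonnegative value of a cut \<open>(U, X - U)\<close>
  separating \<open>x\<close> from \<open>y\<close>, and the value of a cut is the least indirect margin across it. This
  expression mentions neither the admissible order nor \<open>Y\<close>.\<close>

section \<open>Strict total orders on finite sets\<close>

locale finite_strict_order =
  fixes A :: "'a set" and \<xi> :: "'a rel"
  assumes finite_A: "finite A"
    and order_subset: "\<xi> \<subseteq> opairs A"
    and order_linear: "strict_linear_order_on A \<xi>"
begin

lemma order_trans: "(x, y) \<in> \<xi> \<Longrightarrow> (y, z) \<in> \<xi> \<Longrightarrow> (x, z) \<in> \<xi>"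
  using order_linear by (auto simp: strict_linear_order_on_def dest: transD)

lemma order_irrefl: "(x, x) \<notin> \<xi>"
  using order_subset by (auto simp: opairs_def)

lemma order_asym: "(x, y) \<in> \<xi> \<Longrightarrow> (y, x) \<notin> \<xi>"
  using order_trans order_irrefl by blast

lemma order_total: "x \<in> A \<Longrightarrow> y \<in> A \<Longrightarrow> x \<noteq> y \<Longrightarrow> (x, y) \<in> \<xi> \<or> (y, x) \<in> \<xi>"
  using order_linear by (auto simp: strict_linear_order_on_def total_on_def)

lemma order_mem: "(x, y) \<in> \<xi> \<Longrightarrow> x \<in> A \<and> y \<in> A \<and> x \<noteq> y"
  using order_subset by (auto simp: opairs_def)

lemma finite_order: "finite \<xi>"
  using finite_subset[OF order_subset, OF finite_subset[of _ "A \<times> A"]] finite_A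
  by (auto simp: opairs_def)

lemma wf_order: "wf \<xi>" and wf_converse_order: "wf (\<xi>\<inverse>)"
proof -
  have "trans \<xi>" using order_trans by (auto intro: transI)
  then have "acyclic \<xi>" by (simp add: acyclic_def trancl_id order_irrefl)
  then show "wf \<xi>" "wf (\<xi>\<inverse>)"
    using finite_order by (auto intro: finite_acyclic_wf finite_acyclic_wf_converse)
qed

lemma obtain_last:
  assumes "S \<subseteq> A" "S \<noteq> {}"
  obtains p where "p \<in> S" "\<And>s. s \<in> S \<Longrightarrow> (s, p) \<in> \<xi>\<^sup>="
proof -
  obtain p where p: "p \<in> S" "\<And>s. (s, p) \<in> \<xi>\<inverse> \<Longrightarrow> s \<notin> S"
    using wfE_min'[OF wf_converse_order assms(2)] by metis
  then show thesis using that order_total assms(1) by (metis converse_iff UnCI subsetD pair_in_Id_conv)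
qed

lemma obtain_first:
  assumes "S \<subseteq> A" "S \<noteq> {}"
  obtains p where "p \<in> S" "\<And>s. s \<in> S \<Longrightarrow> (p, s) \<in> \<xi>\<^sup>="
proof -
  obtain p where p: "p \<in> S" "\<And>s. (s, p) \<in> \<xi> \<Longrightarrow> s \<notin> S"
    using wfE_min'[OF wf_order assms(2)] by metis
  then show thesis using that order_total assms(1) by (metis UnCI subsetD pair_in_Id_conv)
qed

lemma
  assumes "x \<in> Domain \<xi>"
  shows next_option: "(x, next_option \<xi> x) \<in> \<xi>"
    and next_option_le: "(x, z) \<in> \<xi> \<Longrightarrow> (next_option \<xi> x, z) \<in> \<xi>\<^sup>="
proof -
  obtain n where n: "(x, n) \<in> \<xi>" "\<And>s. (x, s) \<in> \<xi> \<Longrightarrow> (n, s) \<in> \<xi>\<^sup>="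
    using obtain_first[of "{s. (x, s) \<in> \<xi>}"] assms order_mem by auto
  have "next_option \<xi> x = n"
    unfolding next_option_def
  proof (rule the_equality)
    show "(x, n) \<in> \<xi> \<and> \<not> (\<exists>z. (x, z) \<in> \<xi> \<and> (z, n) \<in> \<xi>)"
      using n order_asym order_irrefl by fastforce
    show "y = n" if "(x, y) \<in> \<xi> \<and> \<not> (\<exists>z. (x, z) \<in> \<xi> \<and> (z, y) \<in> \<xi>)" for y
      using that n by auto
  qed
  then show "(x, next_option \<xi> x) \<in> \<xi>" "(x, z) \<in> \<xi> \<Longrightarrow> (next_option \<xi> x, z) \<in> \<xi>\<^sup>="
    using n by auto
qed

lemma obtain_previous:
  assumes "(x, z) \<in> \<xi>"
  obtains w where "(x, w) \<in> \<xi>\<^sup>=" "w \<in> Domain \<xi>" "(w, z) \<in> \<xi>" "next_option \<xi> w = z"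
proof -
  obtain w where w: "(w, z) \<in> \<xi>" "\<And>s. (s, z) \<in> \<xi> \<Longrightarrow> (s, w) \<in> \<xi>\<^sup>="
    using obtain_last[of "{s. (s, z) \<in> \<xi>}"] assms order_mem by auto
  have d: "w \<in> Domain \<xi>" using w by auto
  have "next_option \<xi> w = z"
    using next_option_le[OF d w(1)] next_option[OF d] w(2) order_asym order_irrefl by fastforce
  then show thesis using that w assms d by auto
qed

end

section \<open>Indirect scores\<close>

lemma finite_opairs: "finite A \<Longrightarrow> finite (opairs A)"
  by (rule finite_subset[of _ "A \<times> A"]) (auto simp: opairs_def)

lemma path_edge:
  assumes "p \<in> paths A x y" "Suc i < length p"
  shows "(p ! i, p ! Suc i) \<in> opairs A"
  using assms by (auto simp: paths_def opairs_def distinct_adj_conv_nth)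

lemma finite_path_edges: "finite {v (p ! i, p ! Suc i) | i. Suc i < length p}"
proof -
  have "{v (p ! i, p ! Suc i) | i. Suc i < length p}
      \<subseteq> (\<lambda>i. v (p ! i, p ! Suc i)) ` {..<length p}" by auto
  then show ?thesis by (rule finite_subset) auto
qed

text \<open>There may be infinitely many paths, but each score is an entry of \<open>v\<close>. This
  makes the \<open>Max\<close> in \<open>indirect_score\<close> a maximum over a finite set and
  passes the bounds 0 and 1 on to indirect scores.\<close>

lemma path_score_mem:
  assumes "p \<in> paths A x y"
  shows "path_score v p \<in> v ` opairs A"
proof -
  let ?S = "{v (p ! i, p ! Suc i) | i. Suc i < length p}"
  have "Suc 0 < length p" using assms by (auto simp: paths_def)
  then have "?S \<noteq> {}" by blast
  then have "path_score v p \<in> ?S"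
    unfolding path_score_def by (intro Min_in finite_path_edges)
  then show ?thesis using path_edge[OF assms] by auto
qed

lemma path_score_le_edge: "Suc i < length p \<Longrightarrow> path_score v p \<le> v (p ! i, p ! Suc i)"
  unfolding path_score_def by (intro Min_le finite_path_edges) auto

lemma edge_path: "(x, y) \<in> opairs A \<Longrightarrow> [x, y] \<in> paths A x y"
  by (auto simp: paths_def opairs_def)

lemma path_score_edge: "path_score v [x, y] = v (x, y)"
proof -
  have "{v ([x, y] ! i, [x, y] ! Suc i) | i. Suc i < length [x, y]} = {v (x, y)}"
    by auto
  then show ?thesis by (simp add: path_score_def)
qed

lemma finite_path_scores: "finite A \<Longrightarrow> finite (path_score v ` paths A x y)"
  by (rule finite_subset[of _ "v ` opairs A"])
    (auto simp: finite_opairs intro: path_score_mem)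

lemma path_score_le_indirect:
  "finite A \<Longrightarrow> p \<in> paths A x y \<Longrightarrow> path_score v p \<le> indirect_score A v x y"
  unfolding indirect_score_def by (intro Max_ge finite_path_scores) auto

lemma obtain_best_path:
  assumes "finite A" "(x, y) \<in> opairs A"
  obtains p where "p \<in> paths A x y" "indirect_score A v x y = path_score v p"
proof -
  have "indirect_score A v x y \<in> path_score v ` paths A x y"
    unfolding indirect_score_def using assms(1) edge_path[OF assms(2)]
    by (intro Max_in finite_path_scores) auto
  then show thesis using that by auto
qed

lemma llull_bounds:
  assumes "v \<in> llull_matrices A" "(x, y) \<in> opairs A"
  shows "0 \<le> v (x, y)" "v (x, y) \<le> 1" "v (x, y) + v (y, x) \<le> 1"
  using assms by (auto simp: llull_matrices_def PiE_iff)

lemma opairs_sym: "(x, y) \<in> opairs A \<Longrightarrow> (y, x) \<in> opairs A"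
  by (auto simp: opairs_def)

lemma indirect_score_bounds:
  assumes "finite A" "v \<in> llull_matrices A" "(x, y) \<in> opairs A"
  shows "0 \<le> indirect_score A v x y" "indirect_score A v x y \<le> 1"
proof -
  obtain p where "p \<in> paths A x y" "indirect_score A v x y = path_score v p"
    using obtain_best_path assms by metis
  then have "indirect_score A v x y \<in> v ` opairs A" by (simp add: path_score_mem)
  then show "0 \<le> indirect_score A v x y" "indirect_score A v x y \<le> 1"
    using llull_bounds[OF assms(2)] by auto
qed

lemma indirect_margin_le_1:
  assumes "finite A" "v \<in> llull_matrices A" "(x, y) \<in> opairs A"
  shows "indirect_margin A v x y \<le> 1"
  using indirect_score_bounds[OF assms] indirect_score_bounds[OF assms(1,2) opairs_sym[OF assms(3)]]
  by (simp add: indirect_margin_def)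

lemma indirect_margin_antisym: "indirect_margin A v y x = - indirect_margin A v x y"
  by (simp add: indirect_margin_def)

text \<open>Used for paths that meet \<open>Y\<close> and end in \<open>X\<close>: the step found
  here goes back from \<open>Y\<close> to \<open>X\<close>, where \<open>v\<close> vanishes.\<close>

lemma list_crossing:
  assumes "set p \<inter> Y \<noteq> {}" "last p \<notin> Y"
  shows "\<exists>i. Suc i < length p \<and> p ! i \<in> Y \<and> p ! Suc i \<notin> Y"
  using assms
proof (induction p)
  case (Cons a p)
  show ?case
  proof (cases "set p \<inter> Y = {}")
    case True
    then have "a \<in> Y" "p \<noteq> []" using Cons.prems by (auto split: if_splits)
    then have "Suc 0 < length (a # p) \<and> (a # p) ! 0 \<in> Y \<and> (a # p) ! Suc 0 \<notin> Y"
      using True by (cases p) auto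
    then show ?thesis by blast
  next
    case False
    then obtain i where "Suc i < length p" "p ! i \<in> Y" "p ! Suc i \<notin> Y"
      using Cons by (auto split: if_splits)
    then show ?thesis by (intro exI[of _ "Suc i"]) auto
  qed
qed simp

section \<open>Indirect scores when \<open>X\<close> dominates \<open>Y\<close>\<close>

locale dominated_split =
  fixes A X Y :: "'a set" and v :: "'a \<times> 'a \<Rightarrow> real"
  assumes finite: "finite A"
    and partition: "A = X \<union> Y" "X \<inter> Y = {}"
    and llull: "v \<in> llull_matrices A"
    and dominated: "\<And>a b. a \<in> X \<Longrightarrow> b \<in> Y \<Longrightarrow> v (a, b) = 1"
begin

lemma opairs_XY: "a \<in> X \<Longrightarrow> b \<in> Y \<Longrightarrow> (a, b) \<in> opairs A"
  and opairs_X: "(a, b) \<in> opairs X \<Longrightarrow> (a, b) \<in> opairs A"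
  using partition by (auto simp: opairs_def)

lemma converse_dominated: "a \<in> X \<Longrightarrow> b \<in> Y \<Longrightarrow> v (b, a) = 0"
  using llull_bounds[OF llull] dominated opairs_XY opairs_sym
  by (metis add_le_same_cancel1 order_antisym)

lemma path_through_Y:
  assumes "p \<in> paths A x y" "y \<in> X" "set p \<inter> Y \<noteq> {}"
  shows "path_score v p \<le> 0"
proof -
  have "last p \<notin> Y" using assms partition by (auto simp: paths_def)
  then obtain i where i: "Suc i < length p" "p ! i \<in> Y" "p ! Suc i \<notin> Y"
    using list_crossing assms(3) by metis
  then have "p ! Suc i \<in> X"
    using path_edge[OF assms(1) i(1)] partition by (auto simp: opairs_def)
  then have "v (p ! i, p ! Suc i) = 0" using i converse_dominated by auto
  then show ?thesis using path_score_le_edge[OF i(1), of v] by simp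
qed

text \<open>The edge from \<open>a\<close> to \<open>b\<close> alone already scores 1, while each
  path from \<open>b\<close> to \<open>a\<close> starts in \<open>Y\<close> and ends in
  \<open>X\<close>, so \<open>path_through_Y\<close> bounds its score by 0.\<close>

lemma indirect_margin_XY:
  assumes "a \<in> X" "b \<in> Y"
  shows "indirect_margin A v a b = 1"
proof -
  note ab = opairs_XY[OF assms]
  have "1 \<le> indirect_score A v a b"
    using path_score_le_indirect[OF finite edge_path[OF ab], of v] dominated[OF assms]
    by (simp add: path_score_edge)
  moreover have "indirect_score A v b a \<le> 0"
  proof -
    obtain p where p: "p \<in> paths A b a" "indirect_score A v b a = path_score v p"
      using obtain_best_path[OF finite opairs_sym[OF ab]] by metis
    moreover have "set p \<inter> Y \<noteq> {}"
      using p(1) assms hd_in_set[of p] by (fastforce simp: paths_def)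
    ultimately show ?thesis using path_through_Y assms by simp
  qed
  ultimately show ?thesis
    using indirect_score_bounds[OF finite llull ab]
      indirect_score_bounds[OF finite llull opairs_sym[OF ab]]
    by (simp add: indirect_margin_def)
qed

lemma restrict_llull: "restrict v (opairs X) \<in> llull_matrices X"
  using llull_bounds[OF llull opairs_X] opairs_sym[of _ _ X]
  by (auto simp: llull_matrices_def PiE_iff)

text \<open>A path of \<open>A\<close> either stays inside \<open>X\<close> or passes through
  \<open>Y\<close>. In the latter case its score is at most 0, which the nonnegative indirect score
  on \<open>X\<close> matches anyway.\<close>

lemma indirect_score_restrict:
  assumes "(a, b) \<in> opairs X"
  shows "indirect_score X (restrict v (opairs X)) a b = indirect_score A v a b"
proof (rule antisym)
  let ?u = "restrict v (opairs X)"
  have fX: "finite X" using finite partition by simp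
  have eq: "path_score ?u p = path_score v p" if "p \<in> paths X a b" for p
  proof -
    have "{?u (p ! i, p ! Suc i) | i. Suc i < length p} = {v (p ! i, p ! Suc i) | i. Suc i < length p}"
      by (rule Collect_cong) (metis path_edge[OF that] restrict_apply')
    then show ?thesis by (simp add: path_score_def)
  qed
  obtain p where p: "p \<in> paths X a b" "indirect_score X ?u a b = path_score ?u p"
    using obtain_best_path[OF fX assms] by metis
  moreover have "p \<in> paths A a b" using p(1) partition by (auto simp: paths_def)
  ultimately show "indirect_score X ?u a b \<le> indirect_score A v a b"
    using path_score_le_indirect[OF finite] eq by simp
  obtain q where q: "q \<in> paths A a b" "indirect_score A v a b = path_score v q"
    using obtain_best_path[OF finite opairs_X[OF assms]] by metis
  show "indirect_score A v a b \<le> indirect_score X ?u a b"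
  proof (cases "set q \<inter> Y = {}")
    case True
    then have "q \<in> paths X a b" using q(1) partition by (auto simp: paths_def)
    then show ?thesis using path_score_le_indirect[OF fX, of q a b ?u] eq q(2) by simp
  next
    case False
    then have "path_score v q \<le> 0" using path_through_Y[OF q(1)] assms by (auto simp: opairs_def)
    then show ?thesis using q(2) indirect_score_bounds[OF fX restrict_llull assms] by simp
  qed
qed

lemma indirect_margin_restrict:
  "(a, b) \<in> opairs X \<Longrightarrow>
    indirect_margin X (restrict v (opairs X)) a b = indirect_margin A v a b"
  by (simp add: indirect_margin_def indirect_score_restrict opairs_sym)

end

section \<open>Projected margins and turnouts\<close>

locale admissible =
  fixes A :: "'a set" and v :: "'a \<times> 'a \<Rightarrow> real" and \<xi> :: "'a rel"
  assumes options_finite: "finite A"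
    and llull_matrix: "v \<in> llull_matrices A"
    and admissible: "admissible_order A v \<xi>"
begin

sublocale finite_strict_order A \<xi>
  using options_finite admissible by unfold_locales (auto simp: admissible_order_def)

abbreviation "m \<equiv> indirect_margin A v"
abbreviation "m\<sigma> \<equiv> projected_margin A v \<xi>"
abbreviation "nxt \<equiv> next_option \<xi>"

lemma order_opairs: "(x, y) \<in> \<xi> \<Longrightarrow> (x, y) \<in> opairs A"
  using order_subset by auto

lemma positive_margin_order: "(x, y) \<in> opairs A \<Longrightarrow> m x y > 0 \<Longrightarrow> (x, y) \<in> \<xi>"
  using admissible by (auto simp: admissible_order_def indirect_comparison_def)

text \<open>A negative margin would put the reversed pair into the indirect comparison relation and
  hence into \<xi>, against asymmetry.\<close>

lemma order_margin_nonneg: "(x, y) \<in> \<xi> \<Longrightarrow> m x y \<ge> 0"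
  using positive_margin_order[of y x] order_asym[of x y] order_opairs opairs_sym
    indirect_margin_antisym[of A v y x] by force

definition margins_across :: "'a \<Rightarrow> real set" where
  "margins_across x = {m p q | p q. p \<in> A \<and> q \<in> A \<and> (p, x) \<in> \<xi>\<^sup>= \<and> (nxt x, q) \<in> \<xi>\<^sup>=}"

lemma projected_margin_eq: "m\<sigma> x = Min (margins_across x)"
  by (simp add: projected_margin_def margins_across_def)

lemma finite_margins_across: "finite (margins_across x)"
proof -
  have "margins_across x \<subseteq> (\<lambda>(p, q). m p q) ` (A \<times> A)" by (auto simp: margins_across_def)
  then show ?thesis using finite_A by (auto intro: finite_subset)
qed

lemma across_order:
  assumes "x \<in> Domain \<xi>" "(p, x) \<in> \<xi>\<^sup>=" "(nxt x, q) \<in> \<xi>\<^sup>="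
  shows "(p, q) \<in> \<xi>"
  using assms next_option[OF assms(1)] order_trans by blast

lemma obtain_projected_margin:
  assumes "x \<in> Domain \<xi>"
  obtains p q where "(p, x) \<in> \<xi>\<^sup>=" "(nxt x, q) \<in> \<xi>\<^sup>=" "(p, q) \<in> \<xi>" "m\<sigma> x = m p q"
proof -
  have "m x (nxt x) \<in> margins_across x"
    using next_option[OF assms] order_mem by (auto simp: margins_across_def)
  then have "m\<sigma> x \<in> margins_across x"
    unfolding projected_margin_eq using finite_margins_across by (intro Min_in) auto
  then show thesis using that across_order[OF assms] by (auto simp: margins_across_def)
qed

lemma projected_margin_le:
  assumes "x \<in> Domain \<xi>" "(p, x) \<in> \<xi>\<^sup>=" "(nxt x, q) \<in> \<xi>\<^sup>="
  shows "m\<sigma> x \<le> m p q"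
proof -
  have "m p q \<in> margins_across x"
    using assms order_mem across_order[OF assms] unfolding margins_across_def by blast
  then show ?thesis unfolding projected_margin_eq using finite_margins_across by simp
qed

lemma projected_margin_bounds:
  assumes "x \<in> Domain \<xi>"
  shows "0 \<le> m\<sigma> x" "m\<sigma> x \<le> 1"
proof -
  obtain p q where "(p, q) \<in> \<xi>" "m\<sigma> x = m p q"
    using obtain_projected_margin[OF assms] by metis
  then show "0 \<le> m\<sigma> x" "m\<sigma> x \<le> 1"
    using order_margin_nonneg indirect_margin_le_1[OF finite_A llull_matrix order_opairs] by auto
qed

section \<open>Feasible turnouts: bounds, compactness\<close>

abbreviation "F \<equiv> feasible_turnouts A v \<xi>"

lemma
  assumes "\<tau> \<in> F"
  shows feasible_ext: "\<tau> \<in> extensional (opairs A)"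
    and feasible_sym: "(x, y) \<in> opairs A \<Longrightarrow> \<tau> (x, y) = \<tau> (y, x)"
    and feasible_next: "x \<in> Domain \<xi> \<Longrightarrow> m\<sigma> x \<le> \<tau> (x, nxt x) \<and> \<tau> (x, nxt x) \<le> 1"
    and feasible_step: "x \<in> Domain \<xi> \<Longrightarrow> z \<in> A - {x, nxt x} \<Longrightarrow>
        0 \<le> \<tau> (x, z) - \<tau> (nxt x, z) \<and> \<tau> (x, z) - \<tau> (nxt x, z) \<le> m\<sigma> x"
  using assms by (auto simp: feasible_turnouts_def PiE_iff)

lemma feasibleI:
  assumes "\<tau> \<in> extensional (opairs A)"
    and "\<And>x y. (x, y) \<in> opairs A \<Longrightarrow> \<tau> (x, y) = \<tau> (y, x)"
    and "\<And>x. x \<in> Domain \<xi> \<Longrightarrow> m\<sigma> x \<le> \<tau> (x, nxt x)"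
    and "\<And>x. x \<in> Domain \<xi> \<Longrightarrow> \<tau> (x, nxt x) \<le> 1"
    and "\<And>x z. x \<in> Domain \<xi> \<Longrightarrow> z \<in> A - {x, nxt x} \<Longrightarrow> 0 \<le> \<tau> (x, z) - \<tau> (nxt x, z)"
    and "\<And>x z. x \<in> Domain \<xi> \<Longrightarrow> z \<in> A - {x, nxt x} \<Longrightarrow> \<tau> (x, z) - \<tau> (nxt x, z) \<le> m\<sigma> x"
  shows "\<tau> \<in> F"
  unfolding feasible_turnouts_def mem_Collect_eq
  using assms(1) by (intro conjI ballI) (auto simp: PiE_iff simp del: diff_ge_0_iff_ge intro: assms(2-6))

lemma next_opairs: "x \<in> Domain \<xi> \<Longrightarrow> (x, nxt x) \<in> opairs A"
  using next_option order_opairs by auto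

lemma step_opairs:
  assumes "x \<in> Domain \<xi>" "z \<in> A - {x, nxt x}"
  shows "(x, z) \<in> opairs A" "(nxt x, z) \<in> opairs A"
  using assms next_opairs[of x] by (auto simp: opairs_def)

text \<open>The constraints relate neighbours only. Moving \<open>x\<close> forward to the
  predecessor of \<open>z\<close> never increases the entry, and there it is at least a projected
  margin, hence nonnegative.\<close>

lemma feasible_ge_0_order:
  assumes "\<tau> \<in> F" "(x, z) \<in> \<xi>"
  shows "0 \<le> \<tau> (x, z)"
  using assms(2)
proof (induction x rule: wf_induct_rule[OF wf_converse_order])
  case (1 x)
  then have d: "x \<in> Domain \<xi>" by auto
  show ?case
  proof (cases "z = nxt x")
    case True
    then show ?thesis
      using feasible_next[OF assms(1) d] projected_margin_bounds[OF d] by auto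
  next
    case False
    then have "(nxt x, z) \<in> \<xi>" using next_option_le[OF d 1(2)] by auto
    then have "0 \<le> \<tau> (nxt x, z)" using 1(1) next_option[OF d] by auto
    moreover have "z \<in> A - {x, nxt x}" using False 1(2) order_mem by auto
    ultimately show ?thesis using feasible_step[OF assms(1) d] by force
  qed
qed

text \<open>Dual to the lower bound: \<open>z\<close> moves back until it is the successor of
  \<open>x\<close>, where the constraint gives 1 directly.\<close>

lemma feasible_le_1_order:
  assumes "\<tau> \<in> F" "(x, z) \<in> \<xi>"
  shows "\<tau> (x, z) \<le> 1"
  using assms(2)
proof (induction z rule: wf_induct_rule[OF wf_order])
  case (1 z)
  obtain w where w: "(x, w) \<in> \<xi>\<^sup>=" "w \<in> Domain \<xi>" "(w, z) \<in> \<xi>" "nxt w = z"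
    using obtain_previous[OF 1(2)] by metis
  show ?case
  proof (cases "w = x")
    case True
    then show ?thesis using feasible_next[OF assms(1) w(2)] w by auto
  next
    case False
    then have xw: "(x, w) \<in> \<xi>" using w by auto
    have "x \<in> A - {w, nxt w}" using False 1(2) w(4) order_mem by auto
    \<comment> \<open>The step constraint varies the first argument only, so symmetry of \<tau> is
      used to move the second one.\<close>
    then have "\<tau> (z, x) \<le> \<tau> (w, x)" using feasible_step[OF assms(1) w(2)] w(4) by force
    also have "\<tau> (w, x) = \<tau> (x, w)" using feasible_sym[OF assms(1) order_opairs[OF xw]] by simp
    also have "\<dots> \<le> 1" using 1(1) w xw by auto
    finally show ?thesis using feasible_sym[OF assms(1) order_opairs[OF 1(2)]] by simp
  qed
qed

lemma feasible_bounds: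
  assumes "\<tau> \<in> F" "(x, z) \<in> opairs A"
  shows "0 \<le> \<tau> (x, z) \<and> \<tau> (x, z) \<le> 1"
proof (cases "(x, z) \<in> \<xi>")
  case True
  then show ?thesis using feasible_ge_0_order feasible_le_1_order assms by blast
next
  case False
  then have "(z, x) \<in> \<xi>" using order_total assms(2) by (auto simp: opairs_def)
  then show ?thesis
    using feasible_ge_0_order feasible_le_1_order feasible_sym assms by metis
qed

lemma F_nonempty: "(\<lambda>_\<in>opairs A. 1) \<in> F"
  by (rule feasibleI)
    (simp_all add: projected_margin_bounds opairs_sym next_opairs step_opairs del: Diff_insert)

lemma compact_F: "compact F"
proof -
  \<comment> \<open>Outside \<open>opairs A\<close> the factor is the singleton of
    \<open>undefined\<close>, which encodes extensionality. All factors are thus compact, and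
    Tychonoff applies to the product over the whole type.\<close>
  define B where "B = (\<lambda>i. if i \<in> opairs A then {0..1::real} else {undefined})"
  have "compact (PiE UNIV B)"
    using compactin_PiE[of "\<lambda>_. euclidean" UNIV B]
    by (auto simp: euclidean_product_topology compactin_euclidean_iff B_def)
  \<comment> \<open>The defining constraints are closed conditions on single coordinates or pairs of
    them; \<open>feasible_bounds\<close> puts \<open>F\<close> inside the box.\<close>
  moreover define C where "C =
    (\<Inter>z\<in>opairs A. {\<tau>. \<tau> z = \<tau> (snd z, fst z)}) \<inter>
    (\<Inter>x\<in>Domain \<xi>. {\<tau>. m\<sigma> x \<le> \<tau> (x, nxt x)} \<inter> {\<tau>. \<tau> (x, nxt x) \<le> 1}) \<inter>
    (\<Inter>x\<in>Domain \<xi>. \<Inter>z\<in>A - {x, nxt x}.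
       {\<tau>. 0 \<le> \<tau> (x, z) - \<tau> (nxt x, z)} \<inter> {\<tau>. \<tau> (x, z) - \<tau> (nxt x, z) \<le> m\<sigma> x})"
  have "closed C"
    unfolding C_def
    by (intro closed_Int closed_INT ballI closed_Collect_eq closed_Collect_le
        continuous_intros continuous_on_product_coordinates)
  moreover have "F = PiE UNIV B \<inter> C"
  proof (intro set_eqI iffI)
    fix \<tau> assume t: "\<tau> \<in> F"
    have "\<tau> i \<in> B i" for i
      using feasible_bounds[OF t] feasible_ext[OF t]
      by (cases i) (auto simp: B_def extensional_def)
    moreover have "\<tau> \<in> C"
      using feasible_sym[OF t] feasible_next[OF t] feasible_step[OF t] by (auto simp: C_def)
    ultimately show "\<tau> \<in> PiE UNIV B \<inter> C" by auto
  next
    fix \<tau> assume t: "\<tau> \<in> PiE UNIV B \<inter> C"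
    have "\<tau> i = undefined" if "i \<notin> opairs A" for i
      using t that PiE_mem[of \<tau> UNIV B i] by (simp add: B_def)
    then have "\<tau> \<in> extensional (opairs A)" by (simp add: extensional_def)
    moreover have "\<tau> \<in> C" using t by simp
    ultimately show "\<tau> \<in> F"
      by (intro feasibleI) (auto simp: C_def)
  qed
  ultimately show ?thesis by (simp add: compact_Int_closed)
qed

section \<open>Existence and uniqueness of the projected turnouts\<close>

definition cost :: "('a \<times> 'a \<Rightarrow> real) \<Rightarrow> real" where
  "cost \<tau> = (\<Sum>x\<in>A. \<Sum>y\<in>A - {x}. (\<tau> (x, y) - turnout v (x, y))\<^sup>2)"

lemma cost_eq: "cost \<tau> = (\<Sum>z\<in>opairs A. (\<tau> z - turnout v z)\<^sup>2)"
proof -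
  have "opairs A = Sigma A (\<lambda>x. A - {x})" by (auto simp: opairs_def)
  then show ?thesis unfolding cost_def using finite_A
    by (subst sum.Sigma) (auto simp: case_prod_unfold)
qed

lemma obtain_minimizer:
  obtains \<tau> where "\<tau> \<in> F" "\<And>\<rho>. \<rho> \<in> F \<Longrightarrow> cost \<tau> \<le> cost \<rho>"
proof -
  have "continuous_on F cost"
    unfolding cost_eq
    by (intro continuous_intros continuous_on_subset[OF continuous_on_product_coordinates]) auto
  then show thesis
    using continuous_attains_inf[OF compact_F, of cost] F_nonempty that by blast
qed

text \<open>The only instance of convexity of \<open>F\<close> that uniqueness of the minimizer
  requires.\<close>

lemma midpoint_feasible:
  assumes "\<tau> \<in> F" "\<rho> \<in> F"
  shows "(\<lambda>z\<in>opairs A. (\<tau> z + \<rho> z) / 2) \<in> F"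
proof -
  let ?\<mu> = "\<lambda>z\<in>opairs A. (\<tau> z + \<rho> z) / 2"
  show ?thesis
  proof (rule feasibleI)
    show "?\<mu> (x, y) = ?\<mu> (y, x)" if "(x, y) \<in> opairs A" for x y
      using feasible_sym[OF assms(1) that] feasible_sym[OF assms(2) that] that opairs_sym[OF that]
      by simp
    fix x assume x: "x \<in> Domain \<xi>"
    show "m\<sigma> x \<le> ?\<mu> (x, nxt x)" "?\<mu> (x, nxt x) \<le> 1"
      using feasible_next[OF assms(1) x] feasible_next[OF assms(2) x] next_opairs[OF x]
      by simp_all
    fix z assume z: "z \<in> A - {x, nxt x}"
    show "0 \<le> ?\<mu> (x, z) - ?\<mu> (nxt x, z)" "?\<mu> (x, z) - ?\<mu> (nxt x, z) \<le> m\<sigma> x"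
      using feasible_step[OF assms(1) x z] feasible_step[OF assms(2) x z] step_opairs[OF x z]
      by (simp_all add: field_simps)
  qed simp
qed

text \<open>Parallelogram identity: the midpoint costs less than the average of the two costs by a
  quarter of their squared distance, so minimality forces this distance to be 0.\<close>

lemma minimizer_unique:
  assumes "\<tau> \<in> F" "\<And>\<rho>. \<rho> \<in> F \<Longrightarrow> cost \<tau> \<le> cost \<rho>"
    and "\<rho> \<in> F" "cost \<rho> \<le> cost \<tau>"
  shows "\<rho> = \<tau>"
proof -
  let ?\<mu> = "\<lambda>z\<in>opairs A. (\<tau> z + \<rho> z) / 2"
  have "cost ?\<mu> = (\<Sum>z\<in>opairs A. (\<tau> z - turnout v z)\<^sup>2 / 2 + (\<rho> z - turnout v z)\<^sup>2 / 2 - (\<tau> z - \<rho> z)\<^sup>2 / 4)"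
    unfolding cost_eq by (intro sum.cong) (auto simp: field_simps power2_eq_square)
  also have "\<dots> = cost \<tau> / 2 + cost \<rho> / 2 - (\<Sum>z\<in>opairs A. (\<tau> z - \<rho> z)\<^sup>2) / 4"
    by (simp add: cost_eq sum.distrib sum_subtractf sum_divide_distrib)
  finally have "(\<Sum>z\<in>opairs A. (\<tau> z - \<rho> z)\<^sup>2) \<le> 0"
    using assms(2)[OF midpoint_feasible[OF assms(1,3)]] assms(4) by simp
  then have "(\<Sum>z\<in>opairs A. (\<tau> z - \<rho> z)\<^sup>2) = 0"
    by (simp add: order_antisym sum_nonneg)
  then have "\<forall>z\<in>opairs A. \<tau> z = \<rho> z"
    using finite_opairs[OF finite_A] by (simp add: sum_nonneg_eq_0_iff)
  then show ?thesis
    using feasible_ext[OF assms(1)] feasible_ext[OF assms(3)] by (metis extensionalityI)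
qed

text \<open>Justifies the definite description in \<open>projected_turnout\<close>.\<close>

lemma
  shows projected_turnout_feasible: "projected_turnout A v \<xi> \<in> F"
    and projected_turnout_min: "\<rho> \<in> F \<Longrightarrow> cost (projected_turnout A v \<xi>) \<le> cost \<rho>"
proof -
  obtain \<tau> where \<tau>: "\<tau> \<in> F" "\<And>\<rho>. \<rho> \<in> F \<Longrightarrow> cost \<tau> \<le> cost \<rho>"
    using obtain_minimizer by metis
  have "projected_turnout A v \<xi> = \<tau>"
    unfolding projected_turnout_def cost_def[symmetric]
  proof (rule the_equality)
    show "is_arg_min cost (\<lambda>\<tau>. \<tau> \<in> F) \<tau>"
      using \<tau> by (force simp: is_arg_min_def)
    show "\<rho> = \<tau>" if "is_arg_min cost (\<lambda>\<tau>. \<tau> \<in> F) \<rho>" for \<rho>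
      using that \<tau> by (intro minimizer_unique) (auto simp: is_arg_min_def not_less)
  qed
  then show "projected_turnout A v \<xi> \<in> F" "\<rho> \<in> F \<Longrightarrow> cost (projected_turnout A v \<xi>) \<le> cost \<rho>"
    using \<tau> by auto
qed

end

section \<open>Separation of two options by cuts\<close>

definition cut_value :: "'a set \<Rightarrow> ('a \<Rightarrow> 'a \<Rightarrow> real) \<Rightarrow> 'a set \<Rightarrow> real" where
  "cut_value X m U = Min {m a b | a b. a \<in> U \<and> b \<in> X - U}"

definition separation :: "'a set \<Rightarrow> ('a \<Rightarrow> 'a \<Rightarrow> real) \<Rightarrow> 'a \<Rightarrow> 'a \<Rightarrow> real" where
  \<comment> \<open>The inserted 0 discards cuts of negative value. It makes the separation vanish
    against the order, so that one formula serves for both directions of a pair.\<close>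
  "separation X m x y = Max (insert 0 {cut_value X m U | U. U \<subseteq> X \<and> x \<in> U \<and> y \<notin> U})"

text \<open>The two sides of a cut are disjoint, so only margins of distinct options enter; the
  margins on \<open>A\<close> and on \<open>X\<close> are known to agree just there.\<close>

lemma separation_cong:
  assumes "\<And>a b. (a, b) \<in> opairs X \<Longrightarrow> m a b = m' a b"
  shows "separation X m x y = separation X m' x y"
proof -
  have "cut_value X m U = cut_value X m' U" if "U \<subseteq> X" for U
  proof -
    have "m a b = m' a b" if "a \<in> U" "b \<in> X - U" for a b
      using that \<open>U \<subseteq> X\<close> by (intro assms) (auto simp: opairs_def)
    then have "{m a b | a b. a \<in> U \<and> b \<in> X - U} = {m' a b | a b. a \<in> U \<and> b \<in> X - U}"
      by (intro Collect_cong) metis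
    then show ?thesis by (simp add: cut_value_def)
  qed
  then have "{cut_value X m U | U. U \<subseteq> X \<and> x \<in> U \<and> y \<notin> U}
      = {cut_value X m' U | U. U \<subseteq> X \<and> x \<in> U \<and> y \<notin> U}"
    by (intro Collect_cong) metis
  then show ?thesis by (simp add: separation_def)
qed

lemma finite_cut_values: "finite X \<Longrightarrow> finite {cut_value X m U | U. U \<subseteq> X \<and> x \<in> U \<and> y \<notin> U}"
  by (rule finite_subset[of _ "cut_value X m ` Pow X"]) auto

lemma finite_cut:
  assumes "finite X" "U \<subseteq> X"
  shows "finite {m a b | a b. a \<in> U \<and> b \<in> X - U}"
  by (rule finite_subset[of _ "(\<lambda>(a, b). m a b) ` (X \<times> X)"]) (use assms in auto)

lemma cut_value_le:
  "finite X \<Longrightarrow> U \<subseteq> X \<Longrightarrow> a \<in> U \<Longrightarrow> b \<in> X - U \<Longrightarrow> cut_value X m U \<le> m a b"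
  unfolding cut_value_def by (intro Min_le finite_cut) auto

lemma cut_value_ge:
  assumes "finite X" "U \<subseteq> X" "x \<in> U" "y \<in> X - U"
    and "\<And>a b. a \<in> U \<Longrightarrow> b \<in> X - U \<Longrightarrow> r \<le> m a b"
  shows "r \<le> cut_value X m U"
  unfolding cut_value_def using assms finite_cut[OF assms(1,2), of m]
  by (subst Min_ge_iff) auto

lemma separation_ge_cut:
  "finite X \<Longrightarrow> U \<subseteq> X \<Longrightarrow> x \<in> U \<Longrightarrow> y \<notin> U \<Longrightarrow> cut_value X m U \<le> separation X m x y"
  unfolding separation_def by (intro Max_ge) (auto simp: finite_cut_values)

lemma separation_le:
  assumes "finite X" "0 \<le> r"
    and "\<And>U. U \<subseteq> X \<Longrightarrow> x \<in> U \<Longrightarrow> y \<notin> U \<Longrightarrow> cut_value X m U \<le> r"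
  shows "separation X m x y \<le> r"
  unfolding separation_def using assms by (auto simp: finite_cut_values)

lemma separation_nonneg: "finite X \<Longrightarrow> 0 \<le> separation X m x y"
  unfolding separation_def by (intro Max_ge) (auto simp: finite_cut_values)

section \<open>Dominating options with full turnout\<close>

text \<open>\<open>Y\<close> may be empty, so that the locale applies both to \<open>A = X \<union> Y\<close> and to \<open>X\<close> alone.\<close>

locale dominated_order = dominated_split A X Y v + admissible A v \<xi>
  for A X Y :: "'a set" and v \<xi> +
  assumes full: "\<And>a b. (a, b) \<in> opairs X \<Longrightarrow> v (a, b) + v (b, a) = 1"
begin

lemma finite_X: "finite X"
  using finite_A partition by simp

lemma order_XY: "a \<in> X \<Longrightarrow> b \<in> Y \<Longrightarrow> (a, b) \<in> \<xi>"
  by (rule positive_margin_order) (simp_all add: opairs_XY indirect_margin_XY)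

lemma order_downward: "(a, b) \<in> \<xi> \<Longrightarrow> b \<in> X \<Longrightarrow> a \<in> X"
  using order_XY[of b a] order_asym order_mem[of a b] partition by blast

lemma full_turnout:
  assumes "(a, b) \<in> opairs A" "a \<in> X \<or> b \<in> X"
  shows "turnout v (a, b) = 1"
proof -
  consider "(a, b) \<in> opairs X" | "a \<in> X" "b \<in> Y" | "a \<in> Y" "b \<in> X"
    using assms partition by (auto simp: opairs_def)
  then show ?thesis
    by cases (simp_all add: turnout_def full dominated converse_dominated)
qed

text \<open>At the boundary between the blocks every pair across leads from \<open>X\<close> to
  \<open>Y\<close>, so the minimum is over margins equal to 1.\<close>

lemma projected_margin_XY:
  assumes "x \<in> X" "x \<in> Domain \<xi>" "nxt x \<in> Y"
  shows "m\<sigma> x = 1"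
proof -
  obtain p q where pq: "(p, x) \<in> \<xi>\<^sup>=" "(nxt x, q) \<in> \<xi>\<^sup>=" "(p, q) \<in> \<xi>" "m\<sigma> x = m p q"
    using obtain_projected_margin[OF assms(2)] by metis
  have "p \<in> X" using pq(1) order_downward assms(1) by auto
  moreover have "q \<notin> X" using pq(2) order_downward assms(3) partition by blast
  then have "q \<in> Y" using pq(3) order_mem partition by blast
  ultimately show ?thesis using indirect_margin_XY pq(4) by simp
qed

text \<open>Overwriting the minimizer by 1 on all pairs that meet \<open>X\<close> keeps it feasible, because the
  margin between the two blocks is 1, and does not increase its cost.\<close>

lemma projected_turnout_1:
  assumes "(a, b) \<in> opairs A" "a \<in> X \<or> b \<in> X"
  shows "projected_turnout A v \<xi> (a, b) = 1"
proof -
  define t where "t = projected_turnout A v \<xi>"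
  define s where "s = (\<lambda>z\<in>opairs A. if fst z \<in> X \<or> snd z \<in> X then 1 else t z)"
  have t: "t \<in> F" "\<And>\<rho>. \<rho> \<in> F \<Longrightarrow> cost t \<le> cost \<rho>"
    using projected_turnout_feasible projected_turnout_min by (auto simp: t_def)
  have "s \<in> F"
  proof (rule feasibleI)
    show "s \<in> extensional (opairs A)" by (simp add: s_def)
    show "s (x, y) = s (y, x)" if "(x, y) \<in> opairs A" for x y
      using that opairs_sym[OF that] feasible_sym[OF t(1) that] by (auto simp: s_def)
    fix x assume x: "x \<in> Domain \<xi>"
    show "m\<sigma> x \<le> s (x, nxt x)" "s (x, nxt x) \<le> 1"
      using feasible_next[OF t(1) x] next_opairs[OF x] projected_margin_bounds[OF x]
      by (auto simp: s_def)
    fix z assume z: "z \<in> A - {x, nxt x}"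
    have "0 \<le> s (x, z) - s (nxt x, z) \<and> s (x, z) - s (nxt x, z) \<le> m\<sigma> x"
    \<comment> \<open>The only case in which exactly one of the two entries is overwritten. The
      difference is 1 minus an entry in [0,1], and the allowed step is 1.\<close>
    proof (cases "x \<in> X \<and> nxt x \<notin> X \<and> z \<notin> X")
      case True
      then have "nxt x \<in> Y" using next_opairs[OF x] partition by (auto simp: opairs_def)
      then have "m\<sigma> x = 1" using projected_margin_XY True x by blast
      then show ?thesis
        using True step_opairs[OF x z] feasible_bounds[OF t(1) step_opairs(2)[OF x z]]
        by (simp add: s_def)
    next
      case False
      \<comment> \<open>Either both entries are now 1, or both are overwritten or kept together: as
        \<open>X\<close> is an initial segment, \<open>nxt x\<close> in \<open>X\<close> implies
        \<open>x\<close> in \<open>X\<close>.\<close>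
      then have "z \<in> X \<or> (x \<in> X \<longleftrightarrow> nxt x \<in> X)"
        using order_downward[OF next_option[OF x]] by blast
      then show ?thesis
        using step_opairs[OF x z] feasible_step[OF t(1) x z] projected_margin_bounds[OF x]
        by (auto simp: s_def)
    qed
    then show "0 \<le> s (x, z) - s (nxt x, z)" "s (x, z) - s (nxt x, z) \<le> m\<sigma> x" by auto
  qed
  \<comment> \<open>Each overwritten entry equals its target turnout 1 and contributes nothing to
    the cost.\<close>
  moreover have "cost s \<le> cost t"
    unfolding cost_eq by (intro sum_mono) (auto simp: s_def full_turnout)
  ultimately have "s = t" using minimizer_unique t by blast
  then show ?thesis using assms by (auto simp: s_def t_def[symmetric] dest: fun_cong[of _ _ "(a, b)"])
qed

section \<open>Projected scores of options in \<open>X\<close>\<close>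

lemma
  assumes "p \<in> X" "p \<in> Domain \<xi>"
  shows upper_score_X: "upper_score A v \<xi> p = (1 + m\<sigma> p) / 2"
    and lower_score_X: "lower_score A v \<xi> p = (1 - m\<sigma> p) / 2"
  using projected_turnout_1[OF next_opairs[OF assms(2)]] assms
  by (simp_all add: upper_score_def lower_score_def)

abbreviation "stretch x y \<equiv> {p. (x, p) \<in> \<xi>\<^sup>= \<and> (p, y) \<in> \<xi>}"

lemma finite_stretch: "finite (stretch x y)"
  by (rule finite_subset[OF _ finite_A]) (auto dest: order_mem)

text \<open>A cut of positive value is an initial segment of every admissible order, so ranging over
  all cuts instead of the initial segments of \<open>\<xi>\<close> makes no difference.\<close>

lemma separation_order:
  assumes "(x, y) \<in> \<xi>" "y \<in> X"
  shows "Max (m\<sigma> ` stretch x y) = separation X m x y"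
proof (rule antisym)
  have fin: "finite (m\<sigma> ` stretch x y)" using finite_stretch by blast
  have ne: "x \<in> stretch x y" using assms by auto
  have "m\<sigma> p \<le> separation X m x y" if p: "p \<in> stretch x y" for p
  proof -
    have d: "p \<in> Domain \<xi>" using p by auto
    \<comment> \<open>Initial segment ending at \<open>p\<close>: all pairs across this cut of
      \<open>X\<close> also compete in the minimum that defines \<open>m\<sigma> p\<close>.\<close>
    define U where "U = {a. (a, p) \<in> \<xi>\<^sup>=}"
    have pX: "p \<in> X" using p assms order_downward by blast
    then have U: "U \<subseteq> X" "x \<in> U" "y \<notin> U"
      using p order_downward order_asym order_irrefl by (auto simp: U_def)
    have "m\<sigma> p \<le> cut_value X m U"
    proof (rule cut_value_ge[OF finite_X U(1,2)])
      show "y \<in> X - U" using U assms by auto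
      fix a b assume a: "a \<in> U" and b: "b \<in> X - U"
      have "(p, b) \<in> \<xi>" using b pX order_total[of p b] partition by (auto simp: U_def)
      then show "m\<sigma> p \<le> m a b"
        using a projected_margin_le[OF d] next_option_le[OF d] by (auto simp: U_def)
    qed
    then show ?thesis using separation_ge_cut[OF finite_X U, of m] by linarith
  qed
  then show "Max (m\<sigma> ` stretch x y) \<le> separation X m x y"
    using fin ne by (subst Max_le_iff) auto
  have Max0: "0 \<le> Max (m\<sigma> ` stretch x y)"
  proof -
    have "0 \<le> m\<sigma> x" using projected_margin_bounds assms by blast
    also have "m\<sigma> x \<le> Max (m\<sigma> ` stretch x y)" using fin ne by (intro Max_ge) auto
    finally show ?thesis .
  qed
  show "separation X m x y \<le> Max (m\<sigma> ` stretch x y)"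
  proof (rule separation_le[OF finite_X Max0])
    fix U assume U: "U \<subseteq> X" "x \<in> U" "y \<notin> U"
    show "cut_value X m U \<le> Max (m\<sigma> ` stretch x y)"
    proof (cases "cut_value X m U \<le> 0")
      case True
      then show ?thesis using Max0 by simp
    next
      case False
      have UX: "(a, b) \<in> \<xi>" if "a \<in> U" "b \<in> X - U" for a b
      proof (rule positive_margin_order)
        show "(a, b) \<in> opairs A" using that U partition by (auto simp: opairs_def)
        show "m a b > 0" using cut_value_le[OF finite_X U(1) that, of m] False by simp
      qed
      have UA: "U \<subseteq> A" "U \<noteq> {}" using U partition by auto
      \<comment> \<open>A positive cut places all of \<open>U\<close> before the rest of
        \<open>X\<close>. With \<open>p\<close> the last element of \<open>U\<close>, the pair
        attaining \<open>m\<sigma> p\<close> starts in \<open>U\<close> and ends outside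
        \<open>U\<close>.\<close>
      obtain p where p: "p \<in> U" "\<And>s. s \<in> U \<Longrightarrow> (s, p) \<in> \<xi>\<^sup>="
        using obtain_last[OF UA] by metis
      have py: "(p, y) \<in> \<xi>" using UX p(1) U assms by auto
      then have d: "p \<in> Domain \<xi>" by auto
      obtain a b where ab: "(a, p) \<in> \<xi>\<^sup>=" "(nxt p, b) \<in> \<xi>\<^sup>=" "(a, b) \<in> \<xi>" "m\<sigma> p = m a b"
        using obtain_projected_margin[OF d] by metis
      have aX: "a \<in> X" using ab(1) p(1) U order_downward by auto
      have a: "a \<in> U"
        using ab(1) p(1) UX[of p a] aX order_asym by blast
      have "(p, b) \<in> \<xi>" using across_order[OF d _ ab(2), of p] by auto
      then have b: "b \<notin> U" using p(2) order_asym order_irrefl by blast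
      have "cut_value X m U \<le> m a b"
      proof (cases "b \<in> X")
        case True
        then show ?thesis using a b cut_value_le[OF finite_X U(1)] by auto
      next
        \<comment> \<open>Here \<open>b\<close> lies in \<open>Y\<close>, outside the cut of
          \<open>X\<close>. Its margin is 1, which no value of a cut separating \<open>x\<close>
          from \<open>y\<close> exceeds.\<close>
        case False
        then have "m a b = 1" using ab(3) order_mem partition aX indirect_margin_XY by blast
        moreover have "cut_value X m U \<le> m x y"
          using cut_value_le[OF finite_X U(1)] U assms by auto
        moreover have "m x y \<le> 1"
          by (rule indirect_margin_le_1[OF finite_A llull order_opairs[OF assms(1)]])
        ultimately show ?thesis by linarith
      qed
      also have "m a b \<le> Max (m\<sigma> ` stretch x y)"
        unfolding ab(4)[symmetric] using fin p(2) U(2) py by (intro Max_ge) auto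
      finally show ?thesis .
    qed
  qed
qed

lemma separation_converse:
  assumes "(x, y) \<in> \<xi>" "y \<in> X"
  shows "separation X m y x = 0"
proof (rule antisym[OF separation_le[OF finite_X] separation_nonneg[OF finite_X]])
  fix U assume "U \<subseteq> X" "y \<in> U" "x \<notin> U"
  then have "cut_value X m U \<le> m y x"
    using cut_value_le[OF finite_X] order_downward[OF assms] by auto
  also have "m y x \<le> 0"
    using order_margin_nonneg[OF assms(1)] indirect_margin_antisym[of A v y x] by simp
  finally show "cut_value X m U \<le> 0" .
qed simp

text \<open>With turnout 1, upper scores increase and lower scores decrease with the projected
  margin. Hence the \<open>Max\<close> and the \<open>Min\<close> are both attained where the margin
  is greatest on the stretch.\<close>

lemma
  assumes "(x, y) \<in> \<xi>" "y \<in> X"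
  shows projected_score_down: "projected_score A v \<xi> x y = (1 + separation X m x y) / 2"
    and projected_score_up: "projected_score A v \<xi> y x = (1 - separation X m x y) / 2"
proof -
  let ?B = "stretch x y" and ?M = "separation X m x y"
  have fin: "finite ?B" "?B \<noteq> {}" using finite_stretch assms by auto
  have "?M \<in> m\<sigma> ` ?B"
    unfolding separation_order[OF assms, symmetric] using fin by (intro Max_in) auto
  then obtain p where p: "p \<in> ?B" "m\<sigma> p = ?M"
    by (elim imageE) simp
  have le: "m\<sigma> q \<le> ?M" if "q \<in> ?B" for q
    unfolding separation_order[OF assms, symmetric] using fin that by (intro Max_ge) auto
  have BX: "q \<in> X \<and> q \<in> Domain \<xi>" if "q \<in> ?B" for q
    using that order_downward assms by blast
  have upper: "upper_score A v \<xi> q = (1 + m\<sigma> q) / 2" if "q \<in> ?B" for q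
    using BX[OF that] upper_score_X by blast
  have lower: "lower_score A v \<xi> q = (1 - m\<sigma> q) / 2" if "q \<in> ?B" for q
    using BX[OF that] lower_score_X by blast
  have "Max (upper_score A v \<xi> ` ?B) = (1 + ?M) / 2"
  proof (rule Max_eqI)
    show "(1 + ?M) / 2 \<in> upper_score A v \<xi> ` ?B" using p upper by (intro image_eqI[of _ _ p]) simp_all
  qed (use fin le upper in auto)
  then show "projected_score A v \<xi> x y = (1 + ?M) / 2"
    using assms(1) by (simp add: projected_score_def image_Collect)
  have "Min (lower_score A v \<xi> ` ?B) = (1 - ?M) / 2"
  proof (rule Min_eqI)
    show "(1 - ?M) / 2 \<in> lower_score A v \<xi> ` ?B" using p lower by (intro image_eqI[of _ _ p]) simp_all
  qed (use fin le lower in auto)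
  then show "projected_score A v \<xi> y x = (1 - ?M) / 2"
    using order_asym[OF assms(1)] by (simp add: projected_score_def image_Collect)
qed

lemma projected_score_X:
  assumes "(x, y) \<in> opairs X"
  shows "projected_score A v \<xi> x y = (1 + separation X m x y - separation X m y x) / 2"
proof -
  have xy: "x \<in> X" "y \<in> X" "x \<noteq> y" using assms by (auto simp: opairs_def)
  then consider "(x, y) \<in> \<xi>" | "(y, x) \<in> \<xi>"
    using order_total partition by blast
  then show ?thesis
    by cases (simp_all add: projected_score_down projected_score_up separation_converse xy)
qed

text \<open>The stretch from \<open>x\<close> to \<open>y\<close> contains the last element of
  \<open>X\<close>, where turnout and margin to the successor are both 1, and no upper score exceeds
  1.\<close>

lemma projected_score_XY:
  assumes "x \<in> X" "y \<in> Y"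
  shows "projected_score A v \<xi> x y = 1"
proof -
  let ?B = "stretch x y"
  have xy: "(x, y) \<in> \<xi>" using order_XY assms .
  have "Max (upper_score A v \<xi> ` ?B) = 1"
  proof (rule Max_eqI)
    show "finite (upper_score A v \<xi> ` ?B)" using finite_stretch by blast
    fix r assume "r \<in> upper_score A v \<xi> ` ?B"
    then obtain p where p: "p \<in> Domain \<xi>" "r = upper_score A v \<xi> p" by blast
    then show "r \<le> 1"
      using feasible_next[OF projected_turnout_feasible p(1)] projected_margin_bounds[OF p(1)]
      by (simp add: upper_score_def)
  next
    obtain l where l: "l \<in> X" "\<And>s. s \<in> X \<Longrightarrow> (s, l) \<in> \<xi>\<^sup>="
      using obtain_last[of X] partition assms by blast
    have ly: "(l, y) \<in> \<xi>" using order_XY l(1) assms(2) .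
    then have d: "l \<in> Domain \<xi>" by auto
    have "nxt l \<notin> X"
      using l(2)[of "nxt l"] next_option[OF d] order_asym[of l "nxt l"] order_irrefl by auto
    then have "nxt l \<in> Y" using next_opairs[OF d] partition by (auto simp: opairs_def)
    then have "upper_score A v \<xi> l = 1"
      using upper_score_X[OF l(1) d] projected_margin_XY[OF l(1) d] by simp
    then show "1 \<in> upper_score A v \<xi> ` ?B" using l(2)[OF assms(1)] ly by force
  qed
  then show ?thesis using xy by (simp add: projected_score_def image_Collect)
qed

text \<open>Each option of \<open>Y\<close> contributes 1 to the sum, which lowers
  \<open>card A\<close> to \<open>card X\<close>.\<close>

lemma rank_like_rate_X:
  assumes "x \<in> X"
  shows "rank_like_rate A v \<xi> x =
    real (card X) - (\<Sum>y\<in>X - {x}. (1 + separation X m x y - separation X m y x) / 2)"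
proof -
  have fin: "finite X" "finite Y" using finite_A partition by auto
  have "A - {x} = (X - {x}) \<union> Y" using partition assms by auto
  then have "(\<Sum>y\<in>A - {x}. projected_score A v \<xi> x y)
      = (\<Sum>y\<in>X - {x}. projected_score A v \<xi> x y) + (\<Sum>y\<in>Y. projected_score A v \<xi> x y)"
    using fin partition by (simp add: sum.union_disjoint Int_Diff Diff_Int_distrib2)
  also have "(\<Sum>y\<in>Y. projected_score A v \<xi> x y) = real (card Y)"
    by (simp add: projected_score_XY[OF assms])
  also have "(\<Sum>y\<in>X - {x}. projected_score A v \<xi> x y)
      = (\<Sum>y\<in>X - {x}. (1 + separation X m x y - separation X m y x) / 2)"
    using assms by (intro sum.cong projected_score_X) (auto simp: opairs_def)
  finally show ?thesis
    using fin partition by (simp add: rank_like_rate_def card_Un_disjoint)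
qed

end

section \<open>Ranking votes\<close>

text \<open>A convex combination with positive weights of numbers at most 1 equals 1 only if all of
  them do, and a vote gives the entry 1 only to a listed option.\<close>

lemma dominating_listed:
  assumes "finite K" "\<And>k. k \<in> K \<Longrightarrow> \<alpha> k > 0" "(\<Sum>k\<in>K. \<alpha> k) = 1"
    and "(a, b) \<in> opairs A" "collective_matrix A K \<alpha> L W (a, b) = 1" "k \<in> K"
  shows "a \<in> L k"
proof -
  let ?u = "\<lambda>k. vote_matrix A (L k) (W k) (a, b)"
  have le: "?u k \<le> 1" for k
    using llull_bounds[OF vote_matrix_llull assms(4)] by blast
  have "(\<Sum>k\<in>K. \<alpha> k * (1 - ?u k)) = 0"
    using assms(3-5) by (simp add: collective_matrix_def right_diff_distrib sum_subtractf)
  moreover have "0 \<le> \<alpha> k * (1 - ?u k)" if "k \<in> K" for k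
    using le assms(2)[OF that] by simp
  ultimately have "\<alpha> k * (1 - ?u k) = 0"
    using assms(1,6) by (simp add: sum_nonneg_eq_0_iff)
  then have "?u k = 1" using assms(2)[OF assms(6)] by simp
  then show ?thesis using assms(4) by (auto simp: vote_matrix_def split: if_splits)
qed

text \<open>For two listed options, the opposite entries of each vote add up to 1, in a tie as 1/2 +
  1/2.\<close>

lemma turnout_listed:
  assumes "(\<Sum>k\<in>K. \<alpha> k) = 1" "(a, b) \<in> opairs A"
    and "\<And>k. k \<in> K \<Longrightarrow> a \<in> L k \<and> b \<in> L k"
  shows "collective_matrix A K \<alpha> L W (a, b) + collective_matrix A K \<alpha> L W (b, a) = 1"
proof -
  let ?u = "\<lambda>k. vote_matrix A (L k) (W k)"
  have "?u k (a, b) + ?u k (b, a) = 1" if "k \<in> K" for k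
    using assms(2) assms(3)[OF that] opairs_sym[OF assms(2)] by (auto simp: vote_matrix_def)
  then have "(\<Sum>k\<in>K. \<alpha> k * (?u k (a, b) + ?u k (b, a))) = (\<Sum>k\<in>K. \<alpha> k)"
    by (intro sum.cong) auto
  then show ?thesis
    using assms(1,2) opairs_sym[OF assms(2)]
    by (simp add: collective_matrix_def distrib_left sum.distrib)
qed

theorem theorem7p4:
  fixes A X Y :: "'a set"
    and K :: "'k set"
    and \<alpha> :: "'k \<Rightarrow> real"
    and L :: "'k \<Rightarrow> 'a set"
    and W :: "'k \<Rightarrow> 'a rel"
    and v :: "'a \<times> 'a \<Rightarrow> real"
    and \<xi> \<eta> :: "'a rel"
    and x :: 'a
  assumes "finite A"
    and "A = X \<union> Y" and "X \<inter> Y = {}" and "X \<noteq> {}" and "Y \<noteq> {}"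
    and "finite K"
    and "\<And>k. k \<in> K \<Longrightarrow> \<alpha> k > 0" and "(\<Sum>k\<in>K. \<alpha> k) = 1"
    and "\<And>k. k \<in> K \<Longrightarrow> ranking_vote A (L k) (W k)"
    and "v = collective_matrix A K \<alpha> L W"
    and "\<And>a b. a \<in> X \<Longrightarrow> b \<in> Y \<Longrightarrow> v (a, b) = 1"
    and "admissible_order A v \<xi>"
    and "admissible_order X (restrict v (opairs X)) \<eta>"
    and "x \<in> X"
  shows "rank_like_rate A v \<xi> x = rank_like_rate X (restrict v (opairs X)) \<eta> x"
proof -
  let ?u = "restrict v (opairs X)"
  have llull: "v \<in> llull_matrices A"
    using collective_matrix_llull assms(7,8,10) by metis
  interpret D: dominated_split A X Y v
    using assms llull by unfold_locales auto
  have listed: "a \<in> L k" if "a \<in> X" "k \<in> K" for a k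
  proof -
    \<comment> \<open>Some dominated option has to exist: without it nothing would force the votes
      to list \<open>a\<close>.\<close>
    obtain b where "b \<in> Y" using \<open>Y \<noteq> {}\<close> by blast
    then show ?thesis
      using dominating_listed[OF assms(6-8) D.opairs_XY] assms(10,11) that by metis
  qed
  have full: "v (a, b) + v (b, a) = 1" if "(a, b) \<in> opairs X" for a b
    unfolding assms(10) using turnout_listed[OF assms(8) D.opairs_X[OF that]] listed that
    by (auto simp: opairs_def)
  interpret A: dominated_order A X Y v \<xi>
    using assms llull full by unfold_locales auto
  interpret X: dominated_order X X "{}" ?u \<eta>
    using assms D.restrict_llull full opairs_sym[of _ _ X] by unfold_locales auto
  \<comment> \<open>Both rates are now given by \<open>rank_like_rate_X\<close>, in which the option
    set and the order enter only through margins on \<open>X\<close>; these coincide.\<close>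
  have "separation X A.m a b = separation X X.m a b" for a b
    by (intro separation_cong) (simp add: D.indirect_margin_restrict)
  then show ?thesis
    by (simp add: A.rank_like_rate_X[OF \<open>x \<in> X\<close>] X.rank_like_rate_X[OF \<open>x \<in> X\<close>])
qed

end
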